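(* Let $0<\alpha<n$ and let $p(\cdot)\in\mathcal P_0$ be such that $p(\cdot)\in LH$ and $0<p_-\le p_+<\frac n\alpha$. Define $q(\cdot)$ by $\frac1{p(\cdot)}-\frac1{q(\cdot)}=\frac\alpha n$. Then there is a constant $C$ such that for any countable collection of cubes $\{Q_k\}$ in $\mathbb{R}^n$ and any $\lambda_k>0$, $$\left\|\sum_k\lambda_k|Q_k|^{\frac\alpha n}\chi_{Q_k}\right\|_{L^{q(\cdot)}}\le C\left\|\sum_k\lambda_k\chi_{Q_k}\right\|_{L^{p(\cdot)}}.$$
   Context: Cubes have sides parallel to the coordinate axes. $\mathcal P_0$ is the set of measurable functions $p(\cdot):\mathbb{R}^n\to(0,\infty)$; $p_-=\operatorname{ess\,inf}_{x}p(x)$, $p_+=\operatorname{ess\,sup}_{x}p(x)$. $p(\cdot)\in LH$ means there are constants $C_0,C_\infty,p_\infty$ with $|p(x)-p(y)|\le\frac{C_0}{-\log(|x-y|)}$ for $|x-y|<\frac12$ and $|p(x)-p_\infty|\le\frac{C_\infty}{\log(e+|x|)}$ for all $x$. $\|f\|_{L^{p(\cdot)}}=\inf\left\{\lambda>0:\int_{\mathbb{R}^n}\left(\frac{|f(x)|}{\lambda}\right)^{p(x)}dx\le1\right\}$. *)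

theory Defs
  imports "HOL-Analysis.Analysis" "HOL-Probability.Essential_Supremum"
begin

text \<open>The dimension is \<open>n = CARD('n)\<close>; ``measurable'' and \<open>dx\<close> refer to Lebesgue measure.\<close>

definition exponents :: "(real ^ 'n \<Rightarrow> real) set" (\<open>\<P>\<^sub>0\<close>)
  where "\<P>\<^sub>0 = {p. p \<in> borel_measurable lebesgue \<and> (\<forall>x. 0 < p x)}"

text \<open>Dual to the library's \<open>esssup\<close>; compare \<open>esssup_eq_AE\<close>.\<close>

definition essinf :: "'a measure \<Rightarrow> ('a \<Rightarrow> ereal) \<Rightarrow> ereal"
  where "essinf M f = Sup {z. AE x in M. z \<le> f x}"

definition exp_lower :: "(real ^ 'n \<Rightarrow> real) \<Rightarrow> ereal"
  where "exp_lower p = essinf lebesgue (\<lambda>x. ereal (p x))"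

definition exp_upper :: "(real ^ 'n \<Rightarrow> real) \<Rightarrow> ereal"
  where "exp_upper p = esssup lebesgue (\<lambda>x. ereal (p x))"

text \<open>For \<open>x = y\<close> the first bound reads \<open>0 \<le> 0\<close>, since \<open>ln 0 = 0\<close> and division by zero gives zero;
  this agrees with the usual convention \<open>C\<^sub>0 / \<infinity> = 0\<close>.\<close>

definition log_Hoelder :: "(real ^ 'n \<Rightarrow> real) \<Rightarrow> bool"
  where "log_Hoelder p \<longleftrightarrow>
    (\<exists>C0 Cinf pinf :: real.
      (\<forall>x y. norm (x - y) < 1/2 \<longrightarrow> \<bar>p x - p y\<bar> \<le> C0 / (- ln (norm (x - y)))) \<and>
      (\<forall>x. \<bar>p x - pinf\<bar> \<le> Cinf / ln (exp 1 + norm x)))"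

text \<open>Powers of extended nonnegative reals, meant for exponents \<open>r > 0\<close>.\<close>

definition epowr :: "ennreal \<Rightarrow> real \<Rightarrow> ennreal"
  where "epowr a r = (if a = \<infinity> then \<infinity> else ennreal (enn2real a powr r))"

text \<open>
  The functions take values in \<open>[0, \<infinity>]\<close>, so that \<open>\<bar>f\<bar> = f\<close>; the value \<open>\<infinity>\<close> is needed because a
  countable sum of nonnegative functions may diverge at some points. The (quasi-)norm
  is \<open>\<infinity>\<close> (the infimum of the empty set) if no \<open>l\<close> is admissible.\<close>

definition Lvar_norm :: "(real ^ 'n \<Rightarrow> real) \<Rightarrow> (real ^ 'n \<Rightarrow> ennreal) \<Rightarrow> ennreal"
  where "Lvar_norm p f =
    Inf {ennreal l | l :: real. 0 < l \<and> (\<integral>\<^sup>+ x. epowr (f x / ennreal l) (p x) \<partial>lebesgue) \<le> 1}"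

text \<open>
  Nondegenerate cubes with sides parallel to the axes: products of intervals of one common
  length. Each interval may be open, closed or half-open.\<close>

definition cube :: "(real ^ 'n) set \<Rightarrow> bool"
  where "cube Q \<longleftrightarrow>
    (\<exists>a l J. 0 < l \<and>
      (\<forall>i. {a $ i<..<a $ i + l} \<subseteq> J i \<and> J i \<subseteq> {a $ i..a $ i + l}) \<and>
      Q = {x. \<forall>i. x $ i \<in> J i})"

end

theory Submission
  imports Defs "HOL-Probability.Sinc_Integral"
begin

text \<open>
  Write \<open>f = \<Sum> lam k * indicator (Q k)\<close> and \<open>g\<close> for the same sum with the extra factors
  \<open>len k powr \<alpha>\<close>, where \<open>len k\<close> is the side of \<open>Q k\<close>, so that \<open>len k powr \<alpha>\<close> is
  \<open>measure lebesgue (Q k) powr (\<alpha> / n)\<close>. By homogeneity the modular of \<open>f\<close> may be taken to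
  be at most \<open>1\<close>. The inequality is then true pointwise, up to an integrable error, and no maximal
  function or duality is involved, so that exponents below \<open>1\<close> cause no trouble.

  To see this, take first a constant exponent \<open>p\<close> and fix \<open>x\<close> and a scale \<open>t > 0\<close>. The cubes through
  \<open>x\<close> with side at most about \<open>t\<close> contribute at most \<open>t powr \<alpha> * f x\<close> to \<open>g x\<close>, up to a constant.
  Each cube through \<open>x\<close> with side at least \<open>2 * s\<close> contains one of the \<open>2 ^ n\<close> cells of side \<open>s\<close>
  with a vertex at \<open>x\<close>. Hence, if \<open>a\<close> is the sum of all \<open>lam k\<close> for such cubes, then \<open>f\<close> is at least
  \<open>a / 2 ^ n\<close> on one of the cells, and since the integral of \<open>f powr p\<close> over that cell is at most \<open>1\<close>,
  \<open>a\<close> is bounded by a multiple of \<open>s powr (- n / p)\<close>. Summing over the dyadic scales \<open>s = t * 2 ^ i\<close>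
  gives a convergent geometric series because \<open>\<alpha> < n / p\<close>, with sum comparable to
  \<open>t powr (\<alpha> - n / p)\<close>. For \<open>t = f x powr (- p / n)\<close> both contributions are multiples of
  \<open>f x powr (p / q)\<close>, that is, \<open>g x powr q\<close> is bounded by a multiple of \<open>f x powr p\<close>.

  For a variable exponent the cell argument gives \<open>s powr (- n / p y)\<close> with some \<open>y\<close> in the cell in
  place of \<open>s powr (- n / p x)\<close>. For small \<open>s\<close> the two are comparable by the local log-Hoelder
  condition. For large \<open>s\<close> they are compared through the limit of the exponent at infinity, which
  is why \<open>y\<close> is chosen in a part of the cell at distance at least \<open>s / 4\<close> from the origin. The
  comparison with \<open>p x\<close> itself needs \<open>s\<close> to be at most a power of \<open>exp 1 + norm x\<close>; beyond that
  scale the decay \<open>s powr (- n * rinf)\<close>, with \<open>rinf\<close> the limit of \<open>1 / p\<close>, suffices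
  (\<open>scale_comparison\<close>). All this requires \<open>t\<close> to be at most a power of \<open>exp 1 + norm x\<close>. It is
  achieved by replacing \<open>f x powr p x\<close> with \<open>V = f x powr p x + weight x\<close>, where \<open>weight\<close> is
  integrable but bounded below by a power of \<open>exp 1 + norm x\<close>, and choosing \<open>t = V powr (- 1 / n)\<close>.
  The result is \<open>pointwise_bound\<close>: \<open>g x\<close> is at most a multiple of \<open>V powr (1 / q x)\<close>. Integration
  (\<open>modular_bound\<close>) and scaling finish the proof.
\<close>

section \<open>Log-Hoelder continuity of the reciprocal exponent\<close>

text \<open>If the limit \<open>l\<close> were below \<open>m\<close>, the decay estimate would fail at a point whose norm is so large
  that the right-hand side has dropped below \<open>m - l\<close>.\<close>

lemma limit_at_infinity_lower_bound:
  fixes r :: "real ^ 'n \<Rightarrow> real"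
  assumes decay: "\<And>x. \<bar>r x - l\<bar> \<le> c / ln (exp 1 + norm x)"
    and lower: "\<And>x. m \<le> r x"
  shows "m \<le> l"
proof (rule ccontr)
  assume "\<not> m \<le> l"
  then have d: "0 < m - l" by simp
  obtain x :: "real ^ 'n" where x: "norm x = exp (c / (m - l))"
    using vector_choose_size[of "exp (c / (m - l))"] by auto
  have "ln (norm x) < ln (exp 1 + norm x)"
    by (subst ln_less_cancel_iff) (auto simp: x add_pos_pos)
  then have "c / (m - l) < ln (exp 1 + norm x)" by (simp add: x)
  moreover have "0 < ln (exp 1 + norm x)"
    by (rule ln_gt_zero) (use exp_gt_one[of "1::real"] norm_ge_zero[of x] in linarith)
  ultimately have "c / ln (exp 1 + norm x) < m - l"
    using d by (simp add: field_simps)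
  moreover have "m - l \<le> c / ln (exp 1 + norm x)"
    using decay[of x] lower[of x] by linarith
  ultimately show False by simp
qed

text \<open>Only \<open>1 / p\<close> enters the estimates, so the log-Hoelder conditions are stated for it. A single
  constant \<open>c\<close> serves both conditions.\<close>

locale log_Hoelder_reciprocal =
  fixes p :: "real ^ 'n \<Rightarrow> real" and b B c rinf :: real
  assumes lower_pos: "0 < b"
    and lower: "\<And>x. b \<le> 1 / p x"
    and upper: "\<And>x. 1 / p x \<le> B"
    and local_bound: "\<And>x y. norm (x - y) < 1/2 \<Longrightarrow>
      \<bar>1 / p x - 1 / p y\<bar> \<le> c / (- ln (norm (x - y)))"
    and decay_bound: "\<And>x. \<bar>1 / p x - rinf\<bar> \<le> c / ln (exp 1 + norm x)"
begin

lemma p_pos: "0 < p x"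
  using lower[of x] lower_pos by (metis less_le_trans zero_less_divide_1_iff)

lemma upper_pos: "0 < B"
  using lower[of 0] upper[of 0] lower_pos by linarith

lemma lower_le_limit: "b \<le> rinf"
  by (rule limit_at_infinity_lower_bound[OF decay_bound lower])

lemma ln_weight_ge_1: "1 \<le> ln (exp 1 + norm (x :: real ^ 'n))"
  by (subst ln_ge_iff) (auto intro: add_pos_nonneg)

lemma decay_constant_nonneg: "0 \<le> c"
proof -
  have "0 \<le> c / ln (exp 1 + norm (0 :: real ^ 'n))"
    using decay_bound[of 0] by linarith
  then show ?thesis by simp
qed

text \<open>The form in which decay at infinity is used: the exponent deviates from its limit by so little
  that the deviation is harmless after multiplication by the logarithm of any length \<open>u\<close> that is
  at most polynomial in \<open>exp 1 + norm x\<close>.\<close>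

lemma decay_times_ln:
  assumes "u \<le> k * ln (exp 1 + norm x)" "0 \<le> u" "0 \<le> k"
  shows "\<bar>1 / p x - rinf\<bar> * u \<le> c * k"
proof -
  have L: "0 < ln (exp 1 + norm x)" using ln_weight_ge_1[of x] by linarith
  have "\<bar>1 / p x - rinf\<bar> * u \<le> (c / ln (exp 1 + norm x)) * (k * ln (exp 1 + norm x))"
    using decay_bound[of x] assms decay_constant_nonneg L by (intro mult_mono) auto
  then show ?thesis using L by simp
qed

text \<open>Lets \<open>decay_times_ln\<close> be applied at a point \<open>y\<close> of a cell of side \<open>s\<close> that keeps away from the
  origin, however large \<open>s\<close> is.\<close>

lemma ln_side_le_weight:
  assumes "0 < s" "s / 4 \<le> norm (y :: real ^ 'n)"
  shows "ln s \<le> 3 * ln (exp 1 + norm y)"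
proof -
  let ?w = "exp 1 + norm y"
  have w: "0 < ?w" by (rule add_pos_nonneg) auto
  have e2: "2 \<le> exp (1::real)" using exp_ge_add_one_self[of 1] by simp
  have "4 \<le> ?w ^ 2"
    using power_mono[of 2 ?w 2] e2 norm_ge_zero[of y] by simp
  moreover have "s \<le> 4 * ?w"
  proof -
    have "s \<le> 4 * norm y" using assms(2) by simp
    with exp_ge_zero[of "1::real"] show ?thesis unfolding distrib_left by linarith
  qed
  ultimately have "s \<le> ?w ^ 2 * ?w"
    using w by (meson less_imp_le mult_right_mono order_trans)
  then have "s \<le> ?w ^ 3" by (simp add: power2_eq_square power3_eq_cube)
  then have "ln s \<le> ln (?w ^ 3)" using assms(1) w by (subst ln_le_cancel_iff) auto
  then show ?thesis using w by (simp add: ln_realpow)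
qed

text \<open>This says that \<open>s powr (1 / p x)\<close> and \<open>s powr (1 / p y)\<close> are comparable. Sides below
  \<open>1 / (4 * n ^ 2)\<close> are covered by the local condition, the threshold being chosen such that
  \<open>n * s\<close>, the bound for the distance of \<open>x\<close> and \<open>y\<close>, is below \<open>1/2\<close> and at most the square root
  of \<open>s\<close>. Sides from there to \<open>1\<close> have a bounded logarithm. For sides above \<open>1\<close> both values
  are compared with the limit at infinity.\<close>

lemma oscillation_times_ln:
  assumes s: "0 < s" "s \<le> (exp 1 + norm x) ^ 2"
    and near: "norm (y - x) \<le> real CARD('n) * s" and far: "s / 4 \<le> norm y"
  shows "\<bar>1 / p y - 1 / p x\<bar> * \<bar>ln s\<bar> \<le> 5 * c + B * ln (4 * real CARD('n) ^ 2)"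
proof -
  let ?n = "real CARD('n)"
  let ?d = "\<bar>1 / p y - 1 / p x\<bar>"
  have n: "1 \<le> ?n" by simp
  have n2: "1 \<le> ?n ^ 2" using n by (rule one_le_power)
  have K: "0 \<le> ln (4 * ?n ^ 2)" using n2 by (intro ln_ge_zero) linarith
  have dB: "?d \<le> B"
    using lower[of x] lower[of y] upper[of x] upper[of y] lower_pos by linarith
  have c: "0 \<le> c" by (rule decay_constant_nonneg)
  consider "s < 1 / (4 * ?n ^ 2)" | "1 / (4 * ?n ^ 2) \<le> s" "s \<le> 1" | "1 < s" by linarith
  then show ?thesis
  proof cases
    case 1
    have s1: "s < 1" 
    proof -
      have "1 \<le> 4 * ?n ^ 2" using n2 by linarith
      then have "1 / (4 * ?n ^ 2) \<le> 1" by simp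
      then show ?thesis using 1 by linarith
    qed
    have lns: "ln s < 0" using s(1) s1 by simp
    have ns: "(?n * s) ^ 2 \<le> s"
    proof -
      have "?n ^ 2 * s \<le> 1" using 1 n2 by (simp add: field_simps)
      then have "(?n ^ 2 * s) * s \<le> 1 * s" using s(1) by (intro mult_right_mono) auto
      then show ?thesis by (simp add: power2_eq_square mult_ac)
    qed
    have "(?n * s) ^ 2 < (1/2) ^ 2"
    proof -
      have "?n ^ 2 * s < 1/4" using 1 n2 by (simp add: field_simps)
      moreover have "?n ^ 2 * s * s \<le> ?n ^ 2 * s * 1"
        using s1 s(1) by (intro mult_left_mono) auto
      ultimately show ?thesis by (simp add: power2_eq_square mult_ac)
    qed
    then have half: "?n * s < 1/2" using power_less_imp_less_base[of "?n * s" 2 "1/2"] by simp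
    show ?thesis
    proof (cases "y = x")
      case True
      then show ?thesis using c K upper_pos by simp
    next
      case False
      have pos: "0 < norm (y - x)" using False by simp
      have "ln (norm (y - x)) \<le> ln (?n * s)"
        using pos near s(1) n by (subst ln_le_cancel_iff) (auto intro: mult_pos_pos)
      moreover have "2 * ln (?n * s) \<le> ln s"
      proof -
        have "ln ((?n * s) ^ 2) \<le> ln s" using ns s(1) by (subst ln_le_cancel_iff) auto
        then show ?thesis using s(1) by (simp add: ln_realpow)
      qed
      ultimately have h: "- ln s \<le> 2 * (- ln (norm (y - x)))" by linarith
      have "?d \<le> c / (- ln (norm (y - x)))"
        using local_bound[of y x] near half by linarith
      then have "?d * (- ln s) \<le> (c / (- ln (norm (y - x)))) * (2 * (- ln (norm (y - x))))"
        using h lns c by (intro mult_mono) auto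
      also have "\<dots> = 2 * c" using h lns by simp
      finally show ?thesis using lns c K upper_pos by (simp add: add_increasing2)
    qed
  next
    case 2
    have "ln (1 / (4 * ?n ^ 2)) \<le> ln s" using 2 n2 s(1) by (subst ln_le_cancel_iff) auto
    then have "- ln s \<le> ln (4 * ?n ^ 2)" using n2 by (simp add: ln_div)
    moreover have "ln s \<le> 0" using 2 s(1) by simp
    ultimately have "?d * \<bar>ln s\<bar> \<le> B * ln (4 * ?n ^ 2)"
      using dB upper_pos by (intro mult_mono) auto
    then show ?thesis using c by linarith
  next
    case 3
    have l: "0 \<le> ln s" using 3 by simp
    have w: "0 < exp 1 + norm x" by (rule add_pos_nonneg) auto
    have "ln s \<le> ln ((exp 1 + norm x) ^ 2)" using s w by (subst ln_le_cancel_iff) auto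
    then have "ln s \<le> 2 * ln (exp 1 + norm x)" using w by (simp add: ln_realpow)
    then have a: "\<bar>1 / p x - rinf\<bar> * ln s \<le> c * 2" using l by (intro decay_times_ln) auto
    have bb: "\<bar>1 / p y - rinf\<bar> * ln s \<le> c * 3"
      using l ln_side_le_weight[OF s(1) far] by (intro decay_times_ln) auto
    have "?d * ln s \<le> (\<bar>1 / p y - rinf\<bar> + \<bar>1 / p x - rinf\<bar>) * ln s"
      using l by (intro mult_right_mono) auto
    then have "?d * ln s \<le> 5 * c" using a bb by (simp add: algebra_simps)
    then show ?thesis using l K upper_pos by (simp add: add_increasing2)
  qed
qed

text \<open>The decisive use of log-Hoelder continuity, in logarithmic form. Both \<open>b - 1 / p x\<close> and
  \<open>b - rinf\<close> are nonpositive, so a smaller logarithm gives a larger product. Up to the scale \<open>(exp 1 + norm x) ^ 2\<close> one may replace \<open>p y\<close> by \<open>p x\<close>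
  and then decrease \<open>ln s\<close> to \<open>ln t\<close>. Beyond it one replaces \<open>1 / p y\<close> by \<open>rinf\<close>, decreases \<open>ln s\<close>
  to the logarithm of that scale, changes there from \<open>rinf\<close> to \<open>1 / p x\<close>, and decreases further
  to \<open>ln t\<close>.\<close>

lemma scale_comparison:
  assumes st: "0 < t" "t \<le> s" and t: "t \<le> (exp 1 + norm x) ^ 2"
    and near: "norm (y - x) \<le> real CARD('n) * s" and far: "s / 4 \<le> norm y"
  shows "(b - 1 / p y) * ln s \<le> (5 * c + B * ln (4 * real CARD('n) ^ 2)) + (b - 1 / p x) * ln t"
proof -
  have s: "0 < s" using st by simp
  have ts: "ln t \<le> ln s" using st by simp
  have n2: "1 \<le> real CARD('n) ^ 2" by (rule one_le_power) simp
  have K: "0 \<le> B * ln (4 * real CARD('n) ^ 2)"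
    using n2 upper_pos by (intro mult_nonneg_nonneg ln_ge_zero) linarith+
  show ?thesis
  proof (cases "s \<le> (exp 1 + norm x) ^ 2")
    case True
    have "(1 / p x - 1 / p y) * ln s \<le> \<bar>1 / p y - 1 / p x\<bar> * \<bar>ln s\<bar>"
      by (metis abs_ge_self abs_minus_commute abs_mult)
    also have "\<dots> \<le> (5 * c + B * ln (4 * real CARD('n) ^ 2))"
      by (rule oscillation_times_ln[OF s True near far])
    finally have "(b - 1 / p y) * ln s \<le> (5 * c + B * ln (4 * real CARD('n) ^ 2)) + (b - 1 / p x) * ln s"
      by (simp add: algebra_simps)
    also have "(b - 1 / p x) * ln s \<le> (b - 1 / p x) * ln t"
      using lower[of x] ts by (intro mult_left_mono_neg) auto
    finally show ?thesis by simp
  next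
    case False
    let ?T = "(exp 1 + norm x) ^ 2"
    have w: "0 < exp 1 + norm x" by (rule add_pos_nonneg) auto
    have lnT: "ln ?T = 2 * ln (exp 1 + norm x)" using w by (simp add: ln_realpow)
    have T0: "0 \<le> ln ?T" using lnT ln_weight_ge_1[of x] by linarith
    have Ts: "ln ?T \<le> ln s" using False w s by (subst ln_le_cancel_iff) auto
    have tT: "ln t \<le> ln ?T" using t st w by (subst ln_le_cancel_iff) auto
    have a: "\<bar>1 / p y - rinf\<bar> * ln s \<le> c * 3"
      using T0 Ts ln_side_le_weight[OF s far] by (intro decay_times_ln) auto
    have a': "(rinf - 1 / p y) * ln s \<le> \<bar>1 / p y - rinf\<bar> * ln s"
      using T0 Ts by (intro mult_right_mono) auto
    have d: "\<bar>1 / p x - rinf\<bar> * ln ?T \<le> c * 2"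
      using T0 lnT by (intro decay_times_ln) auto
    have d': "(1 / p x - rinf) * ln ?T \<le> \<bar>1 / p x - rinf\<bar> * ln ?T"
      using T0 by (intro mult_right_mono) auto
    have "(b - rinf) * ln s \<le> (b - rinf) * ln ?T"
      using lower_le_limit Ts by (intro mult_left_mono_neg) auto
    moreover have "(b - 1 / p x) * ln ?T \<le> (b - 1 / p x) * ln t"
      using lower[of x] tT by (intro mult_left_mono_neg) auto
    ultimately have "(b - 1 / p y) * ln s \<le> 5 * c + (b - 1 / p x) * ln t"
      using a a' d d' by (simp add: algebra_simps)
    then show ?thesis using K by simp
  qed
qed

text \<open>The surplus factor \<open>(t / s) powr (n * b)\<close> makes the sum over dyadic scales \<open>s \<ge> t\<close> converge.\<close>

lemma scale_comparison_powr:
  obtains D where "0 < D"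
    "\<And>x y s t. 0 < t \<Longrightarrow> t \<le> s \<Longrightarrow> t \<le> (exp 1 + norm x) ^ 2 \<Longrightarrow>
      norm (y - x) \<le> real CARD('n) * s \<Longrightarrow> s / 4 \<le> norm y \<Longrightarrow>
      s powr (- (real CARD('n) / p y))
        \<le> D * t powr (- (real CARD('n) / p x)) * (t / s) powr (real CARD('n) * b)"
proof
  let ?n = "real CARD('n)"
  let ?K = "5 * c + B * ln (4 * ?n ^ 2)"
  show "0 < exp (?n * ?K)" by simp
  fix x y :: "real ^ 'n" and s t :: real
  assume st: "0 < t" "t \<le> s" and t: "t \<le> (exp 1 + norm x) ^ 2"
    and near: "norm (y - x) \<le> real CARD('n) * s" and far: "s / 4 \<le> norm y"
  have s: "0 < s" using st by simp
  have "?n * ((b - 1 / p y) * ln s) \<le> ?n * (?K + (b - 1 / p x) * ln t)"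
    by (intro mult_left_mono scale_comparison st t near far) auto
  then have "- (?n / p y) * ln s
      \<le> ?n * ?K + - (?n / p x) * ln t + ?n * b * (ln t - ln s)"
    by (simp add: algebra_simps)
  then have "exp (- (?n / p y) * ln s)
      \<le> exp (?n * ?K + - (?n / p x) * ln t + ?n * b * (ln t - ln s))" by simp
  then show "s powr (- (?n / p y)) \<le> exp (?n * ?K)
      * t powr (- (?n / p x)) * (t / s) powr (?n * b)"
    using s st by (simp only: exp_add) (simp add: powr_def ln_div)
qed

end

text \<open>Continuity is what turns essential bounds on the exponent into bounds at every point.\<close>

lemma continuous_if_log_Hoelder:
  fixes p :: "real ^ 'n \<Rightarrow> real"
  assumes "\<And>x y. norm (x - y) < 1/2 \<Longrightarrow> \<bar>p x - p y\<bar> \<le> C / (- ln (norm (x - y)))"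
  shows "continuous_on UNIV p"
proof -
  have "(p \<longlongrightarrow> p x) (at x)" for x
  proof -
    have r: "((\<lambda>r. C / (- ln r)) \<longlongrightarrow> 0) (at_right 0)"
    proof (rule tendsto_divide_0[OF tendsto_const])
      show "filterlim (\<lambda>r::real. - ln r) at_infinity (at_right 0)"
        by (rule filterlim_at_top_imp_at_infinity)
           (simp add: filterlim_uminus_at_bot[symmetric] ln_at_0)
    qed
    have n: "filterlim (\<lambda>y. norm (y - x)) (at_right 0) (at x)"
      unfolding filterlim_at
      by (auto intro!: tendsto_eq_intros simp: eventually_at_filter)
    have "((\<lambda>y. p y - p x) \<longlongrightarrow> 0) (at x)"
    proof (rule Lim_null_comparison)
      show "((\<lambda>y. C / (- ln (norm (y - x)))) \<longlongrightarrow> 0) (at x)"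
        by (rule filterlim_compose[OF r n])
      show "\<forall>\<^sub>F y in at x. norm (p y - p x) \<le> C / - ln (norm (y - x))"
        unfolding eventually_at
        by (rule exI[of _ "1/2"]) (use assms in \<open>auto simp: dist_norm\<close>)
    qed
    then show ?thesis by (simp add: LIM_zero_iff)
  qed
  then show ?thesis by (simp add: continuous_on_def)
qed

text \<open>The exceptional set is open and negligible, hence empty.\<close>

lemma AE_imp_everywhere_closed:
  fixes p :: "real ^ 'n \<Rightarrow> real"
  assumes "continuous_on UNIV p" "closed A" "AE x in lebesgue. p x \<in> A"
  shows "p x \<in> A"
proof -
  have "p -` (- A) = {x. \<not> p x \<in> A}" by auto
  then have "open {x. \<not> p x \<in> A}"
    using assms(1,2) by (metis open_Compl open_vimage)
  moreover have "negligible {x. \<not> p x \<in> A}"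
    using assms(3) by (auto simp: negligible_iff_null_sets AE_iff_null_sets eventually_ae_filter
        intro: null_sets_completion_subset)
  ultimately have "{x. \<not> p x \<in> A} = {}" using open_not_negligible by blast
  then show ?thesis by blast
qed

lemma bounds_from_essential_bounds:
  fixes p :: "real ^ 'n \<Rightarrow> real"
  assumes "continuous_on UNIV p" "0 < exp_lower p" "exp_upper p < ereal u"
  obtains m P where "0 < m" "P < u" "\<And>x. m \<le> p x" "\<And>x. p x \<le> P"
proof -
  obtain z where z: "0 < z" "AE x in lebesgue. z \<le> ereal (p x)"
    using assms(2) unfolding exp_lower_def essinf_def less_Sup_iff by auto
  obtain m where m: "ereal 0 < ereal m" "ereal m < z"
    using z(1) ereal_dense2[of 0 z] by (auto simp: zero_ereal_def)
  have "AE x in lebesgue. p x \<in> {m..}"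
    using z(2) by eventually_elim (use m(2) in \<open>metis atLeast_iff ereal_less_eq(3) less_imp_le order_trans\<close>)
  then have 1: "m \<le> p x" for x
    using AE_imp_everywhere_closed[OF assms(1), of "{m..}" x] by simp
  obtain P where P: "exp_upper p < ereal P" "ereal P < ereal u"
    using ereal_dense2[OF assms(3)] by auto
  have "AE x in lebesgue. p x \<in> {..P}"
    using esssup_AE[of "\<lambda>x. ereal (p x)" lebesgue]
    by eventually_elim
       (use P(1) in \<open>metis exp_upper_def atMost_iff ereal_less_eq(3) less_imp_le order_trans\<close>)
  then have 2: "p x \<le> P" for x
    using AE_imp_everywhere_closed[OF assms(1), of "{..P}" x] by simp
  show ?thesis using that[of m P] m P 1 2 by simp
qed

text \<open>Since \<open>p\<close> is bounded away from \<open>0\<close>, and so is its limit at infinity, taking reciprocals multiplies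
  differences by at most \<open>1 / m ^ 2\<close>, with \<open>m\<close> a positive lower bound.\<close>

lemma log_Hoelder_reciprocal_exists:
  fixes p :: "real ^ 'n \<Rightarrow> real"
  assumes LH: "log_Hoelder p" and "0 < exp_lower p" "exp_upper p < ereal (1 / a)" "0 < a"
  obtains b B c rinf where "a < b" "log_Hoelder_reciprocal p b B c rinf"
proof -
  obtain C0 Cinf pinf where
    l: "\<And>x y. norm (x - y) < 1/2 \<Longrightarrow> \<bar>p x - p y\<bar> \<le> C0 / (- ln (norm (x - y)))"
    and i: "\<And>x. \<bar>p x - pinf\<bar> \<le> Cinf / ln (exp 1 + norm x)"
    using LH unfolding log_Hoelder_def by auto
  have cont: "continuous_on UNIV p" using l by (rule continuous_if_log_Hoelder)
  obtain m P where m: "0 < m" "P < 1 / a" "\<And>x. m \<le> p x" "\<And>x. p x \<le> P"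
    using bounds_from_essential_bounds[OF cont assms(2,3)] by blast
  have pinf: "m \<le> pinf" by (rule limit_at_infinity_lower_bound[OF i m(3)])
  have P: "0 < P" using m(1) m(3)[of 0] m(4)[of 0] by linarith
  have recip: "\<bar>1 / u - 1 / v\<bar> \<le> (1 / m ^ 2) * \<bar>u - v\<bar>" if "m \<le> u" "m \<le> v" for u v
  proof -
    have uv: "0 < u" "0 < v" using that m(1) by auto
    have "1 / u - 1 / v = (v - u) / (u * v)" using uv by (simp add: field_simps)
    then have "\<bar>1 / u - 1 / v\<bar> = \<bar>u - v\<bar> / (u * v)"
      using uv by (simp add: abs_mult abs_minus_commute)
    also have "\<dots> \<le> \<bar>u - v\<bar> / m ^ 2"
      using that m(1) uv by (intro divide_left_mono) (auto simp: power2_eq_square intro!: mult_mono)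
    finally show ?thesis by simp
  qed
  define c where "c = (1 / m ^ 2) * max C0 Cinf"
  have scale: "(1 / m ^ 2) * v \<le> c / L" if "v \<le> C / L" "0 \<le> L" "C \<le> max C0 Cinf" for v C L
  proof -
    have "v \<le> max C0 Cinf / L" using that by (meson divide_right_mono order_trans)
    then have "(1 / m ^ 2) * v \<le> (1 / m ^ 2) * (max C0 Cinf / L)"
      by (intro mult_left_mono) auto
    then show ?thesis by (simp add: c_def)
  qed
  have "log_Hoelder_reciprocal p (1 / P) (1 / m) c (1 / pinf)"
  proof
    show "0 < 1 / P" using P by simp
    show "1 / P \<le> 1 / p x" for x using P m(1) m(3)[of x] m(4)[of x] by (simp add: frac_le)
    show "1 / p x \<le> 1 / m" for x using m(1) m(3)[of x] by (simp add: frac_le)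
    show "\<bar>1 / p x - 1 / p y\<bar> \<le> c / - ln (norm (x - y))" if "norm (x - y) < 1 / 2" for x y
    proof -
      have "0 \<le> - ln (norm (x - y))"
        using that by (cases "x = y") auto
      then show ?thesis
        using recip[OF m(3)[of x] m(3)[of y]] scale[OF l[OF that]] by fastforce
    qed
    show "\<bar>1 / p x - 1 / pinf\<bar> \<le> c / ln (exp 1 + norm x)" for x
    proof -
      have "0 \<le> ln (exp 1 + norm x)"
        by (rule ln_ge_zero) (use exp_ge_add_one_self[of "1::real"] norm_ge_zero[of x] in linarith)
      then show ?thesis
        using recip[OF m(3)[of x] pinf] scale[OF i[of x]] by fastforce
    qed
  qed
  moreover have "a < 1 / P" using m(2) P assms(4) by (simp add: field_simps)
  ultimately show ?thesis using that by blast
qed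

section \<open>Cubes through a point and the cells at that point\<close>

lemma emeasure_box_side:
  assumes "0 \<le> l"
  shows "emeasure lebesgue (box a (\<chi> i. a $ i + l) :: (real ^ 'n) set) = ennreal (l ^ CARD('n))"
proof -
  have d: "((\<chi> i. a $ i + l) - a) \<bullet> u = l" if u: "u \<in> Basis" for u :: "real ^ 'n"
  proof -
    obtain i where "u = axis i 1" using u by (auto simp: Basis_vec_def)
    then show ?thesis by (simp add: inner_axis)
  qed
  have le: "a \<bullet> u \<le> (\<chi> i. a $ i + l) \<bullet> u" if "u \<in> Basis" for u :: "real ^ 'n"
    using d[OF that] assms by (simp add: inner_diff_left)
  have "emeasure lborel (box a (\<chi> i. a $ i + l)) = ennreal (\<Prod>u\<in>(Basis :: (real ^ 'n) set). l)"
    by (subst emeasure_lborel_box) (auto simp: le d cong: prod.cong)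
  then show ?thesis by simp
qed

text \<open>Treats open, closed and half-open cubes alike and makes the side a parameter.\<close>

definition between_boxes :: "real \<Rightarrow> (real ^ 'n) set \<Rightarrow> bool"
  where "between_boxes l Q \<longleftrightarrow>
    0 < l \<and> (\<exists>a. box a (\<chi> i. a $ i + l) \<subseteq> Q \<and> Q \<subseteq> cbox a (\<chi> i. a $ i + l))"

lemma cube_between_boxes:
  fixes Q :: "(real ^ 'n) set"
  assumes "cube Q" shows "\<exists>l. between_boxes l Q"
proof -
  obtain a l J where l: "0 < l"
    and J: "\<And>i. {a $ i<..<a $ i + l} \<subseteq> J i \<and> J i \<subseteq> {a $ i..a $ i + l}"
    and Q: "Q = {x. \<forall>i. x $ i \<in> J i}"
    using assms unfolding cube_def by blast
  have "box a (\<chi> i. a $ i + l) \<subseteq> Q"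
    using J by (fastforce simp: Q mem_box_cart)
  moreover have "Q \<subseteq> cbox a (\<chi> i. a $ i + l)"
    using J by (fastforce simp: Q mem_box_cart)
  ultimately show ?thesis using l by (auto simp: between_boxes_def)
qed

text \<open>The faces are negligible, so \<open>Q\<close> differs from the open box by a null set.\<close>

lemma between_boxes_measurable:
  fixes Q :: "(real ^ 'n) set"
  assumes "between_boxes l Q"
  shows "Q \<in> sets lebesgue" "measure lebesgue Q = l ^ CARD('n)"
proof -
  obtain a where l: "0 < l" and a: "box a (\<chi> i. a $ i + l) \<subseteq> Q" "Q \<subseteq> cbox a (\<chi> i. a $ i + l)"
    using assms by (auto simp: between_boxes_def)
  let ?b = "box a (\<chi> i. a $ i + l)"
  have n: "negligible ((?b - Q) \<union> (Q - ?b))"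
    by (rule negligible_subset[OF negligible_frontier_interval[of a "\<chi> i. a $ i + l"]])
       (use a in auto)
  show "Q \<in> sets lebesgue" by (rule sets_negligible_symdiff[OF _ n]) simp
  have "measure lebesgue Q = measure lebesgue ?b"
    by (rule measure_negligible_symdiff[OF _ n]) simp
  also have "\<dots> = enn2real (ennreal (l ^ CARD('n)))"
    unfolding measure_def using l by (subst emeasure_box_side) auto
  finally show "measure lebesgue Q = l ^ CARD('n)" using l by simp
qed

text \<open>The subset \<open>S\<close> selects a cell of side \<open>s\<close> with a vertex at \<open>x\<close>, extending upwards from \<open>x\<close> in the
  coordinates of \<open>S\<close> and downwards in the others; \<open>lo\<close> is its lower end. In each coordinate
  the quarter of the cell farther from \<open>0\<close> is kept: the last quarter if the midpoint
  is nonnegative, the first one otherwise. This forces all coordinates to be at least \<open>s / 4\<close> in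
  absolute value.\<close>

definition far_corner :: "real ^ 'n \<Rightarrow> real \<Rightarrow> 'n set \<Rightarrow> real ^ 'n"
  where "far_corner x s S = (\<chi> i. let lo = (if i \<in> S then x $ i else x $ i - s)
    in if 0 \<le> lo + s / 2 then lo + 3 * s / 4 else lo)"

definition far_cell :: "real ^ 'n \<Rightarrow> real \<Rightarrow> 'n set \<Rightarrow> (real ^ 'n) set"
  where "far_cell x s S = box (far_corner x s S) (\<chi> i. far_corner x s S $ i + s / 4)"

lemma far_cell_sides:
  assumes "0 < s" "y \<in> far_cell x s S"
  shows "s / 4 \<le> \<bar>y $ i\<bar>" "\<bar>y $ i - x $ i\<bar> \<le> s"
    and "i \<in> S \<Longrightarrow> x $ i < y $ i \<and> y $ i < x $ i + s"
    and "i \<notin> S \<Longrightarrow> x $ i - s < y $ i \<and> y $ i < x $ i"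
proof -
  have y: "far_corner x s S $ i < y $ i" "y $ i < far_corner x s S $ i + s / 4"
    using assms(2) by (auto simp: far_cell_def mem_box_cart)
  show "s / 4 \<le> \<bar>y $ i\<bar>" "\<bar>y $ i - x $ i\<bar> \<le> s"
    and "i \<in> S \<Longrightarrow> x $ i < y $ i \<and> y $ i < x $ i + s"
    and "i \<notin> S \<Longrightarrow> x $ i - s < y $ i \<and> y $ i < x $ i"
    using y assms(1) by (auto simp: far_corner_def Let_def split: if_splits)
qed

lemma far_cell_norm:
  fixes x y :: "real ^ 'n"
  assumes "0 < s" "y \<in> far_cell x s S"
  shows "s / 4 \<le> norm y" "norm (y - x) \<le> real CARD('n) * s"
proof -
  show "s / 4 \<le> norm y"
    using far_cell_sides(1)[OF assms] component_le_norm_cart order_trans by blast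
  have "norm (y - x) \<le> (\<Sum>i\<in>UNIV. \<bar>(y - x) $ i\<bar>)" by (rule norm_le_l1_cart)
  also have "\<dots> \<le> (\<Sum>i\<in>(UNIV :: 'n set). s)"
    using far_cell_sides(2)[OF assms] by (intro sum_mono) simp
  finally show "norm (y - x) \<le> real CARD('n) * s" by simp
qed

text \<open>In each coordinate the cube extends from \<open>x\<close> by at least \<open>s\<close> to one of the two sides, because its
  side is at least \<open>2 * s\<close>; \<open>S\<close> collects the coordinates where this is so upwards.\<close>

lemma far_cell_subset_cube:
  assumes "0 < s" "between_boxes l Q" "x \<in> Q" "2 * s \<le> l"
  shows "\<exists>S. far_cell x s S \<subseteq> Q"
proof -
  obtain a where a: "box a (\<chi> i. a $ i + l) \<subseteq> Q" "Q \<subseteq> cbox a (\<chi> i. a $ i + l)"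
    using assms(2) by (auto simp: between_boxes_def)
  let ?S = "{i. x $ i + s \<le> a $ i + l}"
  have x: "a $ i \<le> x $ i" "x $ i \<le> a $ i + l" for i
    using a(2) assms(3) by (auto simp: mem_box_cart dest!: subsetD)
  have "a $ i < y $ i \<and> y $ i < a $ i + l" if "y \<in> far_cell x s ?S" for y i
    using far_cell_sides(3,4)[OF assms(1) that, of i] x[of i] assms(4)
    by (cases "i \<in> ?S") auto
  then have "far_cell x s ?S \<subseteq> box a (\<chi> i. a $ i + l)"
    by (auto simp: mem_box_cart)
  with a(1) show ?thesis by blast
qed

lemma epowr_mono: "a \<le> c \<Longrightarrow> 0 < r \<Longrightarrow> epowr a r \<le> epowr c r"
  by (cases a rule: ennreal_cases; cases c rule: ennreal_cases)
     (auto simp: epowr_def top_unique intro!: ennreal_leI powr_mono2)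

lemma epowr_ennreal: "0 \<le> v \<Longrightarrow> epowr (ennreal v) r = ennreal (v powr r)"
  by (simp add: epowr_def)

context log_Hoelder_reciprocal
begin

text \<open>A finite family whose weighted overlap is controlled by a function of modular at most \<open>1\<close>. Finite
  subfamilies of a countable family share the full sum as a common \<open>f\<close>.\<close>

definition dominated_family ::
    "'k set \<Rightarrow> ('k \<Rightarrow> real) \<Rightarrow> ('k \<Rightarrow> real) \<Rightarrow> ('k \<Rightarrow> (real ^ 'n) set)
      \<Rightarrow> (real ^ 'n \<Rightarrow> ennreal) \<Rightarrow> bool"
  where "dominated_family F lam len Q f \<longleftrightarrow>
    finite F \<and> (\<forall>k\<in>F. 0 \<le> lam k \<and> between_boxes (len k) (Q k)) \<and>
    (\<forall>y. ennreal (\<Sum>k\<in>F. lam k * indicator (Q k) y) \<le> f y) \<and>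
    (\<integral>\<^sup>+ y. epowr (f y) (p y) \<partial>lebesgue) \<le> 1"

text \<open>If \<open>v\<close> violated the bound at every point of the cell, then \<open>v powr p y\<close> would be at least twice the
  reciprocal of the measure of the cell throughout, so that the modular would be at least \<open>2\<close>.\<close>

lemma value_bound_on_cell:
  assumes modular: "(\<integral>\<^sup>+ y. epowr (f y) (p y) \<partial>lebesgue) \<le> 1"
    and s: "0 < s" and v: "0 \<le> v"
    and below: "\<And>y. y \<in> far_cell x s S \<Longrightarrow> ennreal v \<le> f y"
  shows "\<exists>y\<in>far_cell x s S.
    v \<le> (2 * 4 ^ CARD('n)) powr B * s powr (- (real CARD('n) / p y))"
proof (rule ccontr)
  assume contra: "\<not> ?thesis"
  let ?n = "CARD('n)"
  let ?m = "(s / 4) ^ ?n"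
  have m: "0 < ?m" using s by simp
  have "ennreal (2 / ?m) * indicator (far_cell x s S) y \<le> epowr (f y) (p y)" for y
  proof (cases "y \<in> far_cell x s S")
    case True
    have "2 / ?m \<le> v powr p y"
    proof (rule ccontr)
      assume "\<not> 2 / ?m \<le> v powr p y"
      then have "(v powr p y) powr (1 / p y) \<le> (2 / ?m) powr (1 / p y)"
        using p_pos[of y] by (intro powr_mono2) auto
      then have "v \<le> (2 / ?m) powr (1 / p y)"
        using v p_pos[of y] by (simp add: powr_powr)
      also have "2 / ?m = (2 * 4 ^ ?n) * s powr (- real ?n)"
        using s by (simp add: powr_minus powr_realpow power_divide divide_simps)
      also have "((2 * 4 ^ ?n) * s powr (- real ?n)) powr (1 / p y)
          = (2 * 4 ^ ?n) powr (1 / p y) * s powr (- (real ?n / p y))"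
        by (simp add: powr_mult powr_powr)
      also have "\<dots> \<le> (2 * 4 ^ ?n) powr B * s powr (- (real ?n / p y))"
      proof -
        have "(1::real) \<le> 4 ^ ?n" by simp
        then have "(1::real) \<le> 2 * 4 ^ ?n" by linarith
        then show ?thesis using upper[of y] by (intro mult_right_mono powr_mono) auto
      qed
      finally show False using contra True by blast
    qed
    then have "ennreal (2 / ?m) \<le> epowr (ennreal v) (p y)"
      using v by (simp add: epowr_ennreal ennreal_leI)
    also have "\<dots> \<le> epowr (f y) (p y)" using below[OF True] p_pos by (rule epowr_mono)
    finally show ?thesis using True by simp
  qed simp
  then have "(\<integral>\<^sup>+ y. ennreal (2 / ?m) * indicator (far_cell x s S) y \<partial>lebesgue) \<le> 1"
    by (intro order_trans[OF nn_integral_mono modular])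
  moreover have "(\<integral>\<^sup>+ y. ennreal (2 / ?m) * indicator (far_cell x s S) y \<partial>lebesgue)
      = ennreal (2 / ?m) * emeasure lebesgue (far_cell x s S)"
    by (rule nn_integral_cmult_indicator) (simp add: far_cell_def)
  moreover have "emeasure lebesgue (far_cell x s S) = ennreal ?m"
    unfolding far_cell_def using s by (intro emeasure_box_side) auto
  ultimately have "ennreal (2 / ?m * ?m) \<le> 1" using m by (simp add: ennreal_mult flip: ennreal_mult)
  then show False using s by simp
qed

text \<open>Every large cube through \<open>x\<close> contains one of the \<open>2 ^ n\<close> cells at \<open>x\<close>. By the pigeonhole principle some
  cell lies in cubes of total coefficient at least \<open>2 ^ (- n)\<close> times the whole sum, and \<open>f\<close>
  is at least this coefficient on the cell.\<close>

lemma sum_large_cubes: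
  assumes fam: "dominated_family F lam len Q f" and s: "0 < s"
  shows "\<exists>y. norm (y - x) \<le> real CARD('n) * s \<and> s / 4 \<le> norm y \<and>
    (\<Sum>k | k \<in> F \<and> x \<in> Q k \<and> 2 * s \<le> len k. lam k)
      \<le> 2 ^ CARD('n) * (2 * 4 ^ CARD('n)) powr B * s powr (- (real CARD('n) / p y))"
proof -
  have modular: "(\<integral>\<^sup>+ y. epowr (f y) (p y) \<partial>lebesgue) \<le> 1"
    and F: "finite F" "\<And>k. k \<in> F \<Longrightarrow> 0 \<le> lam k" "\<And>k. k \<in> F \<Longrightarrow> between_boxes (len k) (Q k)"
    and below: "\<And>y. ennreal (\<Sum>k\<in>F. lam k * indicator (Q k) y) \<le> f y"
    using fam by (auto simp: dominated_family_def)
  let ?n = "CARD('n)"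
  define A where "A = {k. k \<in> F \<and> x \<in> Q k \<and> 2 * s \<le> len k}"
  have A: "finite A" "A \<subseteq> F" using F(1) by (auto simp: A_def)
  have "\<forall>k\<in>A. \<exists>S. far_cell x s S \<subseteq> Q k"
    unfolding A_def by (blast intro: far_cell_subset_cube[OF s F(3)])
  then obtain \<sigma> where \<sigma>: "\<forall>k\<in>A. far_cell x s (\<sigma> k) \<subseteq> Q k"
    by metis
  \<comment> \<open>Total coefficient of the cubes assigned to the cell \<open>S\<close>; the cell with the largest total is used.\<close>
  define g where "g S = (\<Sum>k | k \<in> A \<and> \<sigma> k = S. lam k)" for S
  have "finite (range g)" by simp
  then have "Max (range g) \<in> range g" by (intro Max_in) auto
  then obtain S where S: "g S = Max (range g)" by (metis imageE)
  have gS: "g S' \<le> g S" for S' unfolding S by (intro Max_ge) auto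
  have "(\<Sum>k\<in>A. lam k) = (\<Sum>S\<in>UNIV. g S)"
    unfolding g_def by (rule sum.group[symmetric]) (use A in auto)
  also have "\<dots> \<le> of_nat (card (UNIV :: 'n set set)) * g S"
    by (rule sum_bounded_above) (rule gS)
  also have "card (UNIV :: 'n set set) = 2 ^ ?n"
    by (metis Pow_UNIV card_Pow finite)
  finally have sum: "(\<Sum>k\<in>A. lam k) \<le> 2 ^ ?n * g S" by simp
  have g0: "0 \<le> g S" unfolding g_def using F(2) A by (intro sum_nonneg) auto
  have "ennreal (g S) \<le> f y" if y: "y \<in> far_cell x s S" for y
  proof -
    have "g S = (\<Sum>k | k \<in> A \<and> \<sigma> k = S. lam k * indicator (Q k) y)"
      unfolding g_def using \<sigma> y by (intro sum.cong) (auto simp: indicator_def)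
    also have "\<dots> \<le> (\<Sum>k\<in>F. lam k * indicator (Q k) y)"
      using F(1,2) A by (intro sum_mono2) auto
    finally show ?thesis using below[of y] by (meson ennreal_leI order_trans)
  qed
  then obtain y where y: "y \<in> far_cell x s S"
    "g S \<le> (2 * 4 ^ ?n) powr B * s powr (- (real ?n / p y))"
    using value_bound_on_cell[OF modular s g0] by blast
  have "(\<Sum>k\<in>A. lam k) \<le> 2 ^ ?n * ((2 * 4 ^ ?n) powr B * s powr (- (real ?n / p y)))"
    by (rule order_trans[OF sum mult_left_mono[OF y(2)]]) simp
  then show ?thesis
    using far_cell_norm[OF s y(1)] unfolding A_def by (auto simp: mult_ac)
qed

end

section \<open>The pointwise estimate\<close>

text \<open>If \<open>l\<close> is at least \<open>2 * t\<close>, then the largest \<open>i\<close> with \<open>2 * t * 2 ^ i \<le> l\<close> alone gives a large enough term.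
  Keeping the other terms makes the right-hand side depend on \<open>l\<close> only through comparisons
  \<open>s \<le> l\<close>, so that summation over cubes produces tail sums.\<close>

lemma powr_le_dyadic_sum:
  fixes l t \<alpha> :: real
  assumes "0 < t" "0 < l" "0 \<le> \<alpha>" "l < 2 * t * 2 ^ N"
  shows "l powr \<alpha> \<le> (2 * t) powr \<alpha>
    + (\<Sum>i<N. if 2 * (t * 2 ^ i) \<le> l then (4 * (t * 2 ^ i)) powr \<alpha> else 0)"
  using assms(4)
proof (induction N)
  case 0
  then show ?case using assms by (auto intro: powr_mono2)
next
  case (Suc N)
  have nonneg: "0 \<le> (\<Sum>i<N. if 2 * (t * 2 ^ i) \<le> l then (4 * (t * 2 ^ i)) powr \<alpha> else 0)"
    by (intro sum_nonneg) auto
  show ?case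
  proof (cases "l < 2 * t * 2 ^ N")
    case True
    then show ?thesis using Suc.IH by simp
  next
    case False
    have "l powr \<alpha> \<le> (4 * (t * 2 ^ N)) powr \<alpha>"
      using Suc.prems assms by (intro powr_mono2) auto
    then show ?thesis using False nonneg by (simp add: add_increasing mult.assoc)
  qed
qed

text \<open>The discrete counterpart of Hedberg's splitting of a fractional integral at a scale \<open>t\<close>: the tail
  bound beats the growth of \<open>len k powr \<alpha>\<close> by the factor \<open>2 powr (- \<delta>)\<close> at each dyadic scale.\<close>

lemma sum_powr_split_at_scale:
  fixes lam len :: "'k \<Rightarrow> real" and A t \<alpha> \<delta> :: real
  assumes I: "finite I" "\<And>k. k \<in> I \<Longrightarrow> 0 \<le> lam k" "\<And>k. k \<in> I \<Longrightarrow> 0 < len k"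
    and par: "0 < t" "0 \<le> \<alpha>" "0 < \<delta>" "0 \<le> A"
    and tail: "\<And>s. t \<le> s \<Longrightarrow>
      (\<Sum>k | k \<in> I \<and> 2 * s \<le> len k. lam k) \<le> A * (t / s) powr (\<alpha> + \<delta>)"
  shows "(\<Sum>k\<in>I. lam k * len k powr \<alpha>)
    \<le> (2 * t) powr \<alpha> * (\<Sum>k\<in>I. lam k) + 4 powr \<alpha> / (1 - 2 powr - \<delta>) * (t powr \<alpha> * A)"
proof -
  obtain N where N: "\<And>k. k \<in> I \<Longrightarrow> len k < 2 * t * 2 ^ N"
  proof -
    define M where "M = Max (insert 0 (len ` I))"
    obtain N where "M / (2 * t) < 2 ^ N" using real_arch_pow[of 2 "M / (2 * t)"] by auto
    then have "M < 2 * t * 2 ^ N" using par(1) by (simp add: field_simps)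
    moreover have "len k \<le> M" if "k \<in> I" for k unfolding M_def using that I(1) by simp
    ultimately show ?thesis using that[of N] by (meson le_less_trans)
  qed
  let ?T = "\<lambda>i::nat. t * 2 ^ i"
  have q: "0 < 2 powr - \<delta>" "2 powr - \<delta> < 1"
    using par(3) powr_less_mono[of "-\<delta>" 0 2] by auto
  have dyadic: "(4 * ?T i) powr \<alpha> * (\<Sum>k | k \<in> I \<and> 2 * ?T i \<le> len k. lam k)
      \<le> 4 powr \<alpha> * (t powr \<alpha> * A) * (2 powr - \<delta>) ^ i" for i
  proof -
    have "1 * t \<le> 2 ^ i * t"
      using par(1) by (intro mult_right_mono one_le_power) auto
    then have "t \<le> ?T i" by (simp add: mult.commute)
    then have "(4 * ?T i) powr \<alpha> * (\<Sum>k | k \<in> I \<and> 2 * ?T i \<le> len k. lam k)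
        \<le> (4 * ?T i) powr \<alpha> * (A * (t / ?T i) powr (\<alpha> + \<delta>))"
      by (intro mult_left_mono tail) auto
    also have "\<dots> = 4 powr \<alpha> * (t powr \<alpha> * A) * (2 powr - \<delta>) ^ i"
    proof -
      have 1: "t / ?T i = 2 powr - real i"
        using par(1) by (simp add: powr_minus powr_realpow divide_simps)
      have 2: "(4 * ?T i) powr \<alpha> = 4 powr \<alpha> * t powr \<alpha> * 2 powr (real i * \<alpha>)"
        using par(1) by (simp add: powr_mult powr_powr flip: powr_realpow)
      have 3: "(2 powr - real i) powr (\<alpha> + \<delta>)
          = 2 powr (- (real i * \<alpha>)) * (2 powr - \<delta>) ^ i" for i
        by (simp add: powr_powr distrib_left mult.commute flip: powr_add powr_realpow)
      have 4: "2 powr (real i * \<alpha>) * 2 powr (- (real i * \<alpha>)) = (1::real)"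
        by (simp flip: powr_add)
      have "4 powr \<alpha> * t powr \<alpha> * 2 powr (real i * \<alpha>) *
          (A * (2 powr (- (real i * \<alpha>)) * (2 powr - \<delta>) ^ i))
          = 4 powr \<alpha> * (t powr \<alpha> * A) * (2 powr - \<delta>) ^ i
            * (2 powr (real i * \<alpha>) * 2 powr (- (real i * \<alpha>)))"
        by (simp only: mult_ac)
      then show ?thesis unfolding 1 2 3 4 by simp
    qed
    finally show ?thesis .
  qed
  have "(\<Sum>k\<in>I. lam k * len k powr \<alpha>)
      \<le> (\<Sum>k\<in>I. lam k * ((2 * t) powr \<alpha>
          + (\<Sum>i<N. if 2 * ?T i \<le> len k then (4 * ?T i) powr \<alpha> else 0)))"
    using I N par by (intro sum_mono mult_left_mono powr_le_dyadic_sum) auto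
  also have "\<dots> = (2 * t) powr \<alpha> * (\<Sum>k\<in>I. lam k)
      + (\<Sum>k\<in>I. \<Sum>i<N. if 2 * ?T i \<le> len k then (4 * ?T i) powr \<alpha> * lam k else 0)"
    by (simp add: distrib_left sum.distrib sum_distrib_left sum_distrib_right mult.commute if_distrib cong: if_cong)
  also have "(\<Sum>k\<in>I. \<Sum>i<N. if 2 * ?T i \<le> len k then (4 * ?T i) powr \<alpha> * lam k else 0)
      = (\<Sum>i<N. \<Sum>k\<in>I. if 2 * ?T i \<le> len k then (4 * ?T i) powr \<alpha> * lam k else 0)"
    by (rule sum.swap)
  also have "\<dots> = (\<Sum>i<N. (4 * ?T i) powr \<alpha> * (\<Sum>k | k \<in> I \<and> 2 * ?T i \<le> len k. lam k))"
    unfolding sum.inter_filter[OF I(1)] sum_distrib_left by (intro sum.cong refl) simp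
  also have "\<dots> \<le> (\<Sum>i<N. 4 powr \<alpha> * (t powr \<alpha> * A) * (2 powr - \<delta>) ^ i)"
    by (rule sum_mono) (rule dyadic)
  also have "\<dots> = 4 powr \<alpha> * (t powr \<alpha> * A) * (\<Sum>i<N. (2 powr - \<delta>) ^ i)"
    by (simp only: sum_distrib_left)
  also have "\<dots> \<le> 4 powr \<alpha> * (t powr \<alpha> * A) * (1 / (1 - 2 powr - \<delta>))"
    using q par by (intro mult_left_mono) (auto simp: sum_gp_strict divide_right_mono)
  finally show ?thesis by (simp add: mult_ac)
qed

context log_Hoelder_reciprocal
begin

text \<open>With \<open>t = V powr (- 1 / n)\<close> one has \<open>t powr (- n / p x) = V powr (1 / p x)\<close>, so that the
  small cubes, through the bound on \<open>f x\<close>, and the large cubes, through \<open>sum_large_cubes\<close> and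
  \<open>scale_comparison_powr\<close>, both contribute a multiple of \<open>t powr \<alpha> * V powr (1 / p x)\<close>. The lower
  bound on \<open>V\<close> says exactly that \<open>t \<le> (exp 1 + norm x) ^ 2\<close>.\<close>

lemma pointwise_bound:
  assumes \<alpha>: "0 < \<alpha>" "\<alpha> / real CARD('n) < b"
  obtains C where "0 < C"
    "\<And>(F :: 'k set) lam len Q f x V. dominated_family F lam len Q f \<Longrightarrow>
      f x \<le> ennreal (V powr (1 / p x)) \<Longrightarrow>
      (exp 1 + norm x) powr (- 2 * real CARD('n)) \<le> V \<Longrightarrow>
      (\<Sum>k\<in>F. lam k * len k powr \<alpha> * indicator (Q k) x)
        \<le> C * V powr (1 / p x - \<alpha> / real CARD('n))"
proof -
  let ?n = "real CARD('n)"
  define \<delta> where "\<delta> = ?n * b - \<alpha>"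
  have \<delta>: "0 < \<delta>" using \<alpha> by (simp add: \<delta>_def field_simps)
  obtain D where D: "0 < D"
    "\<And>x y s t. 0 < t \<Longrightarrow> t \<le> s \<Longrightarrow> t \<le> (exp 1 + norm x) ^ 2 \<Longrightarrow>
      norm (y - x) \<le> ?n * s \<Longrightarrow> s / 4 \<le> norm y \<Longrightarrow>
      s powr (- (?n / p y)) \<le> D * t powr (- (?n / p x)) * (t / s) powr (?n * b)"
    using scale_comparison_powr by blast
  define E where "E = 2 ^ CARD('n) * (2 * 4 ^ CARD('n)) powr B"
  have E: "0 < E" by (simp add: E_def)
  define C where "C = 2 powr \<alpha> + 4 powr \<alpha> / (1 - 2 powr - \<delta>) * (E * D)"
  have q: "2 powr - \<delta> < (1::real)" using \<delta> powr_less_mono[of "-\<delta>" 0 2] by auto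
  show ?thesis
  proof
    show "0 < C" unfolding C_def using q E D(1) by (intro add_pos_pos mult_pos_pos divide_pos_pos) auto
    fix F and lam len :: "'k \<Rightarrow> real" and Q f x V
    assume fam: "dominated_family F lam len Q f"
      and fx: "f x \<le> ennreal (V powr (1 / p x))"
      and V: "(exp 1 + norm x) powr (- 2 * ?n) \<le> V"
    have F: "finite F" "\<And>k. k \<in> F \<Longrightarrow> 0 \<le> lam k" "\<And>k. k \<in> F \<Longrightarrow> between_boxes (len k) (Q k)"
      and below: "\<And>y. ennreal (\<Sum>k\<in>F. lam k * indicator (Q k) y) \<le> f y"
      using fam by (auto simp: dominated_family_def)
    let ?w = "exp 1 + norm x"
    have w: "0 < ?w" by (rule add_pos_nonneg) auto
    have V0: "0 < V" using less_le_trans[OF _ V] w by simp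
    \<comment> \<open>The scale at which the bounds for small and for large cubes balance.\<close>
    define t where "t = V powr (- 1 / ?n)"
    have t: "0 < t" using V0 by (simp add: t_def)
    have tw: "t \<le> ?w ^ 2"
    proof -
      have "V powr (- 1 / ?n) \<le> (?w powr (- 2 * ?n)) powr (- 1 / ?n)"
        using V w by (intro powr_mono2') auto
      also have "\<dots> = ?w powr 2" by (simp add: powr_powr)
      finally show ?thesis using w by (simp add: t_def powr_numeral)
    qed
    have tp: "t powr (- (?n / p x)) = V powr (1 / p x)" by (simp add: t_def powr_powr)
    define I where "I = {k \<in> F. x \<in> Q k}"
    have I: "finite I" "\<And>k. k \<in> I \<Longrightarrow> 0 \<le> lam k" "\<And>k. k \<in> I \<Longrightarrow> 0 < len k"
      using F by (auto simp: I_def between_boxes_def)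
    have on_I: "(\<Sum>k\<in>F. h k * indicator (Q k) x) = (\<Sum>k\<in>I. h k)" for h :: "'k \<Rightarrow> real"
      unfolding I_def sum.inter_filter[OF F(1)]
      by (intro sum.cong) (auto simp: indicator_def)
    have small: "(\<Sum>k\<in>I. lam k) \<le> V powr (1 / p x)"
    proof -
      have "ennreal (\<Sum>k\<in>I. lam k) \<le> ennreal (V powr (1 / p x))"
        using below[of x] fx unfolding on_I by (rule order_trans)
      then show ?thesis by (subst (asm) ennreal_le_iff) auto
    qed
    have large: "(\<Sum>k | k \<in> I \<and> 2 * s \<le> len k. lam k)
        \<le> E * D * V powr (1 / p x) * (t / s) powr (\<alpha> + \<delta>)" if ts: "t \<le> s" for s
    proof -
      have s: "0 < s" using t ts by simp
      obtain y where y: "norm (y - x) \<le> ?n * s" "s / 4 \<le> norm y"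
        "(\<Sum>k | k \<in> F \<and> x \<in> Q k \<and> 2 * s \<le> len k. lam k) \<le> E * s powr (- (?n / p y))"
        using sum_large_cubes[OF fam s, of x] unfolding E_def by blast
      have "{k. k \<in> I \<and> 2 * s \<le> len k} = {k. k \<in> F \<and> x \<in> Q k \<and> 2 * s \<le> len k}"
        by (auto simp: I_def)
      then have "(\<Sum>k | k \<in> I \<and> 2 * s \<le> len k. lam k) \<le> E * s powr (- (?n / p y))"
        using y(3) by simp
      also have "\<dots> \<le> E * (D * t powr (- (?n / p x)) * (t / s) powr (?n * b))"
        using E by (intro mult_left_mono D(2) t ts tw y) auto
      finally show ?thesis unfolding tp by (simp add: \<delta>_def mult_ac)
    qed
    have "(\<Sum>k\<in>I. lam k * len k powr \<alpha>) \<le> (2 * t) powr \<alpha> * (\<Sum>k\<in>I. lam k)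
        + 4 powr \<alpha> / (1 - 2 powr - \<delta>) * (t powr \<alpha> * (E * D * V powr (1 / p x)))"
      by (rule sum_powr_split_at_scale[OF I t _ \<delta> _ large]) (use \<alpha> E D(1) in auto)
    also have "\<dots> \<le> (2 * t) powr \<alpha> * V powr (1 / p x)
        + 4 powr \<alpha> / (1 - 2 powr - \<delta>) * (t powr \<alpha> * (E * D * V powr (1 / p x)))"
      using mult_left_mono[OF small, of "(2 * t) powr \<alpha>"] by simp
    also have "\<dots> = C * (t powr \<alpha> * V powr (1 / p x))"
      using t by (simp add: C_def powr_mult algebra_simps)
    also have "t powr \<alpha> * V powr (1 / p x) = V powr (1 / p x - \<alpha> / ?n)"
      by (simp add: t_def powr_powr flip: powr_add)
    finally show "(\<Sum>k\<in>F. lam k * len k powr \<alpha> * indicator (Q k) x)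
        \<le> C * V powr (1 / p x - \<alpha> / ?n)" unfolding on_I .
  qed
qed

end

section \<open>An integrable weight\<close>

text \<open>A product of one-dimensional integrable functions, for which Tonelli's theorem gives integrability at
  once, decaying only polynomially.\<close>

definition weight :: "real ^ 'n \<Rightarrow> real"
  where "weight x = (\<Prod>u\<in>Basis. inverse (1 + (x \<bullet> u)\<^sup>2))"

lemma weight_nonneg: "0 \<le> weight x"
  unfolding weight_def by (intro prod_nonneg) auto

lemma weight_lower_bound:
  "(exp 1 + norm x) powr (- 2 * real CARD('n)) \<le> weight (x :: real ^ 'n)"
proof -
  let ?w = "exp 1 + norm x"
  have w: "0 < ?w" by (rule add_pos_nonneg) auto
  have "inverse (?w\<^sup>2) \<le> inverse (1 + (x \<bullet> u)\<^sup>2)" if u: "u \<in> Basis" for u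
  proof -
    have "\<bar>x \<bullet> u\<bar> \<le> norm x" using Basis_le_norm[OF u] by simp
    then have "(x \<bullet> u)\<^sup>2 \<le> (norm x)\<^sup>2" by (metis abs_ge_zero power2_abs power_mono)
    moreover have "(1::real) \<le> exp 1 ^ 2" by (simp add: one_le_power)
    moreover have "0 \<le> 2 * exp 1 * norm x" by simp
    ultimately have "1 + (x \<bullet> u)\<^sup>2 \<le> ?w\<^sup>2" unfolding power2_sum by linarith
    then show ?thesis by (intro le_imp_inverse_le) (auto simp: add_pos_nonneg)
  qed
  then have "(\<Prod>u\<in>(Basis :: (real ^ 'n) set). inverse (?w\<^sup>2)) \<le> weight x"
    unfolding weight_def by (intro prod_mono) auto
  moreover have "(\<Prod>u\<in>(Basis :: (real ^ 'n) set). inverse (?w\<^sup>2)) = ?w powr (- 2 * real CARD('n))"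
  proof -
    have "?w powr (- 2 * real CARD('n)) = inverse (?w powr real (2 * CARD('n)))"
      by (simp flip: powr_minus)
    also have "\<dots> = inverse (?w ^ (2 * CARD('n)))" using w by (subst powr_realpow) auto
    also have "\<dots> = (inverse (?w\<^sup>2)) ^ CARD('n)" by (simp only: power_mult power_inverse)
    finally show ?thesis by simp
  qed
  ultimately show ?thesis by simp
qed

lemma weight_measurable [measurable]: "weight \<in> borel_measurable borel"
  unfolding weight_def[abs_def]
  by (intro borel_measurable_continuous_onI continuous_intros) (simp add: add_nonneg_eq_0_iff)

lemma weight_integral_finite: "(\<integral>\<^sup>+ x. ennreal (weight (x :: real ^ 'n)) \<partial>lebesgue) < \<infinity>"
proof -
  let ?h = "\<lambda>r::real. inverse (1 + r\<^sup>2)"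
  have "integrable lborel ?h"
    using integrable_inverse_1_plus_square by (simp add: set_integrable_def)
  then have fin: "(\<integral>\<^sup>+ r. ennreal (?h r) \<partial>lborel) < \<infinity>"
    by (simp add: integrable_iff_bounded)
  have "(\<integral>\<^sup>+ x. ennreal (weight (x :: real ^ 'n)) \<partial>lebesgue)
      = (\<integral>\<^sup>+ x. (\<Prod>u\<in>Basis. ennreal (?h ((x :: real ^ 'n) \<bullet> u))) \<partial>lborel)"
    by (simp add: nn_integral_completion weight_def prod_ennreal)
  also have "\<dots> = (\<Prod>u\<in>(Basis :: (real ^ 'n) set). \<integral>\<^sup>+ r. ennreal (?h r) \<partial>lborel)"
    by (rule nn_integral_lborel_prod) auto
  also have "\<dots> < \<infinity>"
    using fin by (simp add: power_less_top_ennreal)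
  finally show ?thesis .
qed

section \<open>Infinite sums and the modular\<close>

lemma infsum_ennreal_least:
  fixes h :: "'k \<Rightarrow> ennreal"
  assumes "\<And>F. finite F \<Longrightarrow> F \<subseteq> K \<Longrightarrow> sum h F \<le> c"
  shows "infsum h K \<le> c"
proof -
  have "infsum h K = (SUP F\<in>{F. finite F \<and> F \<subseteq> K}. sum h F)"
    by (rule nonneg_infsum_complete) simp
  also have "\<dots> \<le> c" by (rule SUP_least) (use assms in auto)
  finally show ?thesis .
qed

lemma sum_le_infsum_ennreal:
  fixes h :: "'k \<Rightarrow> ennreal"
  assumes "finite F" "F \<subseteq> K"
  shows "sum h F \<le> infsum h K"
proof -
  have "sum h F \<le> (SUP F\<in>{F. finite F \<and> F \<subseteq> K}. sum h F)"
    by (rule SUP_upper) (use assms in simp)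
  also have "\<dots> = infsum h K" by (rule nonneg_infsum_complete[symmetric]) simp
  finally show ?thesis .
qed

lemma infsum_measurable:
  fixes h :: "nat \<Rightarrow> 'a \<Rightarrow> ennreal"
  assumes "\<And>k. k \<in> K \<Longrightarrow> h k \<in> borel_measurable M"
  shows "(\<lambda>x. \<Sum>\<^sub>\<infinity>k\<in>K. h k x) \<in> borel_measurable M"
proof -
  have eq: "(\<lambda>x. \<Sum>\<^sub>\<infinity>k\<in>K. h k x) = (\<lambda>x. SUP F\<in>{F. finite F \<and> F \<subseteq> K}. \<Sum>k\<in>F. h k x)"
    by (rule ext) (rule nonneg_infsum_complete, simp)
  have "countable {F. finite F \<and> F \<subseteq> K}"
    by (rule countable_subset[OF _ countable_Collect_finite]) auto
  then show ?thesis unfolding eq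
  proof (rule borel_measurable_SUP)
    show "(\<lambda>x. \<Sum>k\<in>F. h k x) \<in> borel_measurable M" if "F \<in> {F. finite F \<and> F \<subseteq> K}" for F
      using that assms by (intro borel_measurable_sum) auto
  qed
qed

lemma epowr_measurable:
  assumes [measurable]: "f \<in> borel_measurable M" "p \<in> borel_measurable M"
  shows "(\<lambda>x. epowr (f x) (p x)) \<in> borel_measurable M"
  unfolding epowr_def by measurable

context log_Hoelder_reciprocal
begin

text \<open>The pointwise bound for finite subfamilies passes to the supremum. Raised to the power
  \<open>q x\<close> it bounds the integrand by a multiple of \<open>epowr (f x) (p x) + weight x\<close>, whose integral is at
  most \<open>1 + H\<close>, with \<open>H\<close> the integral of the weight. Let \<open>C\<close> be the
  constant of the pointwise bound. After division of the function by \<open>D\<close>, the bound carries the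
  factor \<open>(C / D) powr q x\<close>, which is at most \<open>(C / D) powr (1 / B)\<close> because \<open>q x\<close> is at least \<open>1 / B\<close>
  and \<open>C / D\<close> is at most \<open>1\<close>; and \<open>D\<close> is chosen to make this the reciprocal of \<open>1 + H\<close>.\<close>

lemma modular_bound:
  fixes q :: "real ^ 'n \<Rightarrow> real"
  assumes \<alpha>: "0 < \<alpha>" "\<alpha> / real CARD('n) < b"
    and q: "\<And>x. 1 / p x - 1 / q x = \<alpha> / real CARD('n)"
    and meas: "p \<in> borel_measurable lebesgue"
  obtains D where "0 < D"
    "\<And>(K :: nat set) lam len Q l. 0 < l \<Longrightarrow> (\<And>k. k \<in> K \<Longrightarrow> 0 < lam k) \<Longrightarrow>
      (\<And>k. k \<in> K \<Longrightarrow> between_boxes (len k) (Q k)) \<Longrightarrow>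
      (\<integral>\<^sup>+ x. epowr ((\<Sum>\<^sub>\<infinity>k\<in>K. ennreal (lam k * indicator (Q k) x)) / ennreal l) (p x) \<partial>lebesgue) \<le> 1 \<Longrightarrow>
      (\<integral>\<^sup>+ x. epowr ((\<Sum>\<^sub>\<infinity>k\<in>K. ennreal (lam k * len k powr \<alpha> * indicator (Q k) x))
        / ennreal (D * l)) (q x) \<partial>lebesgue) \<le> 1"
proof -
  obtain C where C: "0 < C"
    "\<And>(F :: nat set) lam len Q f x V. dominated_family F lam len Q f \<Longrightarrow>
      f x \<le> ennreal (V powr (1 / p x)) \<Longrightarrow>
      (exp 1 + norm x) powr (- 2 * real CARD('n)) \<le> V \<Longrightarrow>
      (\<Sum>k\<in>F. lam k * len k powr \<alpha> * indicator (Q k) x)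
        \<le> C * V powr (1 / p x - \<alpha> / real CARD('n))"
  proof (rule pointwise_bound[where 'k = nat, OF \<alpha>], goal_cases)
    case (1 C)
    show ?case by (rule that) (fact 1)+
  qed
  obtain H where H: "0 \<le> H" "(\<integral>\<^sup>+ x. ennreal (weight (x :: real ^ 'n)) \<partial>lebesgue) = ennreal H"
    using weight_integral_finite[where 'n='n] by (cases rule: ennreal_cases) auto
  define D where "D = C * (1 + H) powr B"
  have D: "0 < D" using C(1) H(1) by (simp add: D_def)
  have CD: "C / D = (1 + H) powr - B" using C(1) by (simp add: D_def powr_minus divide_simps)
  have CD1: "0 < C / D" "C / D \<le> 1"
    using C(1) D H(1) upper_pos ge_one_powr_ge_zero[of "1 + H" B] by (auto simp: D_def)
  have qpos: "0 < q x" and qB: "1 / B \<le> q x" for x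
  proof -
    have "1 / q x = 1 / p x - \<alpha> / real CARD('n)" using q[of x] by simp
    moreover have "0 < \<alpha> / real CARD('n)" using \<alpha>(1) by simp
    ultimately have "0 < 1 / q x" "1 / q x \<le> B"
      using lower[of x] upper[of x] \<alpha>(2) by linarith+
    then show "0 < q x" by simp
    then show "1 / B \<le> q x" using \<open>1 / q x \<le> B\<close> upper_pos by (simp add: field_simps)
  qed
  show ?thesis
  proof (rule that[OF D])
    fix K :: "nat set" and lam len :: "nat \<Rightarrow> real"
      and Q :: "nat \<Rightarrow> (real ^ 'n) set" and l :: real
    assume l: "0 < l" and lam: "\<And>k. k \<in> K \<Longrightarrow> 0 < lam k"
      and Q: "\<And>k. k \<in> K \<Longrightarrow> between_boxes (len k) (Q k)"
    define f where "f x = (\<Sum>\<^sub>\<infinity>k\<in>K. ennreal (lam k * indicator (Q k) x)) / ennreal l" for x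
    define g where "g x = (\<Sum>\<^sub>\<infinity>k\<in>K. ennreal (lam k * len k powr \<alpha> * indicator (Q k) x))" for x
    assume "(\<integral>\<^sup>+ x. epowr ((\<Sum>\<^sub>\<infinity>k\<in>K. ennreal (lam k * indicator (Q k) x)) / ennreal l) (p x) \<partial>lebesgue) \<le> 1"
    then have modular: "(\<integral>\<^sup>+ x. epowr (f x) (p x) \<partial>lebesgue) \<le> 1" by (simp add: f_def)
    have [measurable]: "(\<lambda>x. epowr (f x) (p x)) \<in> borel_measurable lebesgue"
    proof (intro epowr_measurable meas)
      have "(\<lambda>x. \<Sum>\<^sub>\<infinity>k\<in>K. ennreal (lam k * indicator (Q k) x)) \<in> borel_measurable lebesgue"
      proof (rule infsum_measurable)
        fix k assume "k \<in> K"
        note [measurable] = between_boxes_measurable(1)[OF Q[OF this]]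
        show "(\<lambda>x. ennreal (lam k * indicator (Q k) x)) \<in> borel_measurable lebesgue" by measurable
      qed
      then show "f \<in> borel_measurable lebesgue" unfolding f_def[abs_def] by measurable
    qed
    have point: "epowr (g x / ennreal (D * l)) (q x)
        \<le> ennreal (inverse (1 + H)) * (epowr (f x) (p x) + ennreal (weight x))" for x
    proof (cases "f x" rule: ennreal_cases)
      case top
      then show ?thesis using H(1) by (simp add: epowr_def ennreal_mult_top)
    next
      case (real r)
      \<comment> \<open>The weight keeps \<open>V\<close> from being too small for the choice of scale in \<open>pointwise_bound\<close>.\<close>
      define V where "V = r powr p x + weight x"
      have V0: "0 \<le> V" unfolding V_def using weight_nonneg by (intro add_nonneg_nonneg) auto
      have fV: "f x \<le> ennreal (V powr (1 / p x))"
      proof -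
        have "r = (r powr p x) powr (1 / p x)" using real p_pos[of x] by (simp add: powr_powr)
        also have "\<dots> \<le> V powr (1 / p x)"
          using p_pos[of x] weight_nonneg[of x] by (intro powr_mono2) (auto simp: V_def)
        finally show ?thesis using real by (simp add: ennreal_leI)
      qed
      have wV: "(exp 1 + norm x) powr (- 2 * real CARD('n)) \<le> V"
        using weight_lower_bound[of x] by (simp add: V_def add_increasing)
      have "g x \<le> ennreal (l * (C * V powr (1 / q x)))"
        unfolding g_def
      proof (rule infsum_ennreal_least)
        fix F assume F: "finite F" "F \<subseteq> K"
        have "ennreal (\<Sum>k\<in>F. lam k / l * indicator (Q k) y) \<le> f y" for y
        proof -
          have "ennreal (\<Sum>k\<in>F. lam k / l * indicator (Q k) y)
              = ennreal ((\<Sum>k\<in>F. lam k * indicator (Q k) y) / l)"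
            by (simp add: sum_divide_distrib)
          also have "\<dots> = (\<Sum>k\<in>F. ennreal (lam k * indicator (Q k) y)) / ennreal l"
          proof -
            have nonneg: "0 \<le> lam k * indicator (Q k) y" if "k \<in> F" for k
              using F lam[of k] that by (auto simp: less_imp_le)
            then have "0 \<le> (\<Sum>k\<in>F. lam k * indicator (Q k) y)" by (rule sum_nonneg)
            then show ?thesis using l nonneg
              by (subst divide_ennreal[symmetric]) (simp_all only: sum_ennreal)
          qed
          also have "\<dots> \<le> f y"
            unfolding f_def using F by (intro divide_right_mono_ennreal sum_le_infsum_ennreal)
          finally show ?thesis .
        qed
        then have "dominated_family F (\<lambda>k. lam k / l) len Q f"
          using F lam l Q modular by (auto simp: dominated_family_def less_imp_le)
        then have "(\<Sum>k\<in>F. lam k / l * len k powr \<alpha> * indicator (Q k) x)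
            \<le> C * V powr (1 / p x - \<alpha> / real CARD('n))"
          using fV wV by (rule C(2))
        moreover have "1 / p x - \<alpha> / real CARD('n) = 1 / q x" using q[of x] by simp
        moreover have "(\<Sum>k\<in>F. lam k / l * len k powr \<alpha> * indicator (Q k) x)
            = (\<Sum>k\<in>F. lam k * len k powr \<alpha> * indicator (Q k) x) / l"
          by (simp add: sum_divide_distrib)
        ultimately have "(\<Sum>k\<in>F. lam k * len k powr \<alpha> * indicator (Q k) x) / l
            \<le> C * V powr (1 / q x)" by (simp only:)
        then have "(\<Sum>k\<in>F. lam k * len k powr \<alpha> * indicator (Q k) x)
            \<le> l * (C * V powr (1 / q x))"
          unfolding pos_divide_le_eq[OF l] by (simp only: mult.commute[of l])
        then show "(\<Sum>k\<in>F. ennreal (lam k * len k powr \<alpha> * indicator (Q k) x))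
            \<le> ennreal (l * (C * V powr (1 / q x)))"
          using F lam by (subst sum_ennreal) (auto simp: less_imp_le subset_iff intro!: ennreal_leI)
      qed
      then have "g x / ennreal (D * l) \<le> ennreal (l * (C * V powr (1 / q x))) / ennreal (D * l)"
        by (rule divide_right_mono_ennreal)
      also have "\<dots> = ennreal (C / D * V powr (1 / q x))"
        using l D C(1) by (simp add: divide_ennreal)
      finally have "epowr (g x / ennreal (D * l)) (q x)
          \<le> epowr (ennreal (C / D * V powr (1 / q x))) (q x)"
        using qpos by (rule epowr_mono)
      also have "\<dots> = ennreal ((C / D * V powr (1 / q x)) powr q x)"
        using C(1) D by (intro epowr_ennreal) auto
      also have "(C / D * V powr (1 / q x)) powr q x = (C / D) powr q x * V"
        using V0 qpos[of x] CD1 by (subst powr_mult) (simp_all add: powr_powr)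
      also have "ennreal ((C / D) powr q x * V) \<le> ennreal ((C / D) powr (1 / B) * V)"
        using CD1 qB[of x] V0 by (intro ennreal_leI mult_right_mono powr_mono') auto
      also have "(C / D) powr (1 / B) = inverse (1 + H)"
        unfolding CD powr_powr using upper_pos H(1) by (simp add: powr_minus)
      also have "ennreal (inverse (1 + H) * V)
          = ennreal (inverse (1 + H)) * (epowr (f x) (p x) + ennreal (weight x))"
        using real V0 H(1) weight_nonneg[of x]
        by (simp add: V_def ennreal_mult epowr_ennreal flip: ennreal_plus)
      finally show ?thesis .
    qed
    have "(\<integral>\<^sup>+ x. epowr (g x / ennreal (D * l)) (q x) \<partial>lebesgue)
        \<le> (\<integral>\<^sup>+ x. ennreal (inverse (1 + H)) * (epowr (f x) (p x) + ennreal (weight x)) \<partial>lebesgue)"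
      by (intro nn_integral_mono point)
    also have "\<dots> = ennreal (inverse (1 + H))
        * ((\<integral>\<^sup>+ x. epowr (f x) (p x) \<partial>lebesgue) + ennreal H)"
    proof -
      have [measurable]: "(\<lambda>x :: real ^ 'n. ennreal (weight x)) \<in> borel_measurable lebesgue"
        by (intro measurable_completion) measurable
      have "(\<integral>\<^sup>+ x. epowr (f x) (p x) + ennreal (weight x) \<partial>lebesgue)
          = (\<integral>\<^sup>+ x. epowr (f x) (p x) \<partial>lebesgue) + ennreal H"
        unfolding H(2)[symmetric] by (rule nn_integral_add) measurable
      moreover have "(\<lambda>x. epowr (f x) (p x) + ennreal (weight x)) \<in> borel_measurable lebesgue"
        by measurable
      ultimately show ?thesis by (simp only: nn_integral_cmult)
    qed
    also have "\<dots> \<le> ennreal (inverse (1 + H)) * (1 + ennreal H)"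
      using modular by (intro mult_left_mono add_mono) auto
    also have "\<dots> = ennreal (inverse (1 + H) * (1 + H))"
      using H(1) by (subst ennreal_mult) auto
    also have "\<dots> = 1" using H(1) by simp
    finally show "(\<integral>\<^sup>+ x. epowr ((\<Sum>\<^sub>\<infinity>k\<in>K. ennreal (lam k * len k powr \<alpha> * indicator (Q k) x))
        / ennreal (D * l)) (q x) \<partial>lebesgue) \<le> 1" by (simp add: g_def)
  qed
qed

end

section \<open>The norm inequality\<close>

theorem lemma4p10:
  fixes p q :: "real ^ 'n \<Rightarrow> real" and \<alpha> :: real
  assumes "0 < \<alpha>" and "\<alpha> < real CARD('n)"
    and "p \<in> \<P>\<^sub>0" and "log_Hoelder p"
    and "0 < exp_lower p" and "exp_lower p \<le> exp_upper p"
    and "exp_upper p < ereal (real CARD('n) / \<alpha>)"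
    and "\<And>x. 1 / p x - 1 / q x = \<alpha> / real CARD('n)"
  shows "\<exists>C::real. 0 < C \<and>
    (\<forall>(K :: nat set) (Q :: nat \<Rightarrow> (real ^ 'n) set) (lam :: nat \<Rightarrow> real).
      (\<forall>k\<in>K. cube (Q k)) \<longrightarrow> (\<forall>k\<in>K. 0 < lam k) \<longrightarrow>
      Lvar_norm q (\<lambda>x. \<Sum>\<^sub>\<infinity>k\<in>K.
          ennreal (lam k * measure lebesgue (Q k) powr (\<alpha> / real CARD('n)) * indicator (Q k) x))
        \<le> ennreal C * Lvar_norm p (\<lambda>x. \<Sum>\<^sub>\<infinity>k\<in>K. ennreal (lam k * indicator (Q k) x)))"
proof -
  let ?n = "real CARD('n)"
  obtain b B c rinf where b: "\<alpha> / ?n < b" and H: "log_Hoelder_reciprocal p b B c rinf"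
  proof (rule log_Hoelder_reciprocal_exists[OF assms(4,5)])
    show "exp_upper p < ereal (1 / (\<alpha> / ?n))" "0 < \<alpha> / ?n" using assms(1,7) by simp_all
  qed
  interpret log_Hoelder_reciprocal p b B c rinf by (rule H)
  have meas: "p \<in> borel_measurable lebesgue" using assms(3) by (simp add: exponents_def)
  obtain D where D: "0 < D"
    "\<And>(K :: nat set) lam len Q l. 0 < l \<Longrightarrow> (\<And>k. k \<in> K \<Longrightarrow> 0 < lam k) \<Longrightarrow>
      (\<And>k. k \<in> K \<Longrightarrow> between_boxes (len k) (Q k)) \<Longrightarrow>
      (\<integral>\<^sup>+ x. epowr ((\<Sum>\<^sub>\<infinity>k\<in>K. ennreal (lam k * indicator (Q k) x)) / ennreal l) (p x) \<partial>lebesgue) \<le> 1 \<Longrightarrow>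
      (\<integral>\<^sup>+ x. epowr ((\<Sum>\<^sub>\<infinity>k\<in>K. ennreal (lam k * len k powr \<alpha> * indicator (Q k) x))
        / ennreal (D * l)) (q x) \<partial>lebesgue) \<le> 1"
  proof (rule modular_bound[OF assms(1) b assms(8) meas], goal_cases)
    case (1 D)
    show ?case by (rule that) (fact 1)+
  qed
  show ?thesis
  proof (intro exI[of _ D] conjI allI impI)
    show "0 < D" by (rule D(1))
    fix K :: "nat set" and Q :: "nat \<Rightarrow> (real ^ 'n) set" and lam :: "nat \<Rightarrow> real"
    assume cubes: "\<forall>k\<in>K. cube (Q k)" and lam: "\<forall>k\<in>K. 0 < lam k"
    obtain len where len: "\<forall>k\<in>K. between_boxes (len k) (Q k)"
      using bchoice[of K "\<lambda>k l. between_boxes l (Q k)"] cubes cube_between_boxes by blast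
    let ?f = "\<lambda>x. \<Sum>\<^sub>\<infinity>k\<in>K. ennreal (lam k * indicator (Q k) x)"
    let ?g = "\<lambda>x. \<Sum>\<^sub>\<infinity>k\<in>K. ennreal (lam k * measure lebesgue (Q k) powr (\<alpha> / ?n) * indicator (Q k) x)"
    have g: "?g x = (\<Sum>\<^sub>\<infinity>k\<in>K. ennreal (lam k * len k powr \<alpha> * indicator (Q k) x))" for x
    proof (rule infsum_cong)
      fix k assume k: "k \<in> K"
      then have "0 < len k" using len by (auto simp: between_boxes_def)
      then have "measure lebesgue (Q k) powr (\<alpha> / ?n) = len k powr \<alpha>"
        using between_boxes_measurable(2)[OF len[rule_format, OF k]]
        by (simp add: powr_powr flip: powr_realpow)
      then show "ennreal (lam k * measure lebesgue (Q k) powr (\<alpha> / ?n) * indicator (Q k) x)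
          = ennreal (lam k * len k powr \<alpha> * indicator (Q k) x)" by simp
    qed
    \<comment> \<open>If \<open>l\<close> is admissible for the norm of \<open>f\<close>, then \<open>D * l\<close> is admissible for that of \<open>g\<close>.\<close>
    have "Lvar_norm q ?g / ennreal D \<le> Lvar_norm p ?f"
      unfolding Lvar_norm_def[of p]
    proof (rule Inf_greatest)
      fix z assume "z \<in> {ennreal l |l. 0 < l \<and> (\<integral>\<^sup>+ x. epowr (?f x / ennreal l) (p x) \<partial>lebesgue) \<le> 1}"
      then obtain l where z: "z = ennreal l" and l: "0 < l"
        "(\<integral>\<^sup>+ x. epowr (?f x / ennreal l) (p x) \<partial>lebesgue) \<le> 1" by blast
      have "(\<integral>\<^sup>+ x. epowr (?g x / ennreal (D * l)) (q x) \<partial>lebesgue) \<le> 1"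
        unfolding g using len lam l by (intro D(2)) auto
      then have "Lvar_norm q ?g \<le> ennreal (D * l)"
        unfolding Lvar_norm_def using D(1) l(1) by (intro Inf_lower) auto
      also have "\<dots> = ennreal D * z" using D(1) l(1) z by (simp add: ennreal_mult)
      finally show "Lvar_norm q ?g / ennreal D \<le> z"
        using D(1) by (intro divide_le_posI_ennreal) auto
    qed
    then have "ennreal D * (Lvar_norm q ?g / ennreal D) \<le> ennreal D * Lvar_norm p ?f"
      by (rule mult_left_mono) simp
    moreover have "ennreal D * (v / ennreal D) = v" for v
      using D(1) by (metis ennreal_eq_0_iff ennreal_mult_divide_eq ennreal_neq_top
          ennreal_times_divide mult.commute not_less)
    ultimately show "Lvar_norm q ?g \<le> ennreal D * Lvar_norm p ?f" by simp
  qed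
qed

end
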